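(* Let $f\in\mathbb{Q}[x]$ be irreducible of degree $d\ge2$. If $f$ has a binomial multiple, and the minimal degree of such a binomial multiple is $m$, then $m\le d\cdot(\lceil 3d\ln\ln d\rceil+7)$.
   Context: A binomial multiple of $f$ is a multiple of $f$ in $\mathbb{Q}[x]$ of the form $x^m-r$ with $m\ge1$ and $r\in\mathbb{Q}$. *)

theory Defs
  imports Complex_Main "HOL-Computational_Algebra.Polynomial"
begin

definition has_binomial_multiple_of_degree :: "rat poly \<Rightarrow> nat \<Rightarrow> bool" where
  "has_binomial_multiple_of_degree f m \<longleftrightarrow>
     m \<ge> 1 \<and> (\<exists>r::rat. f dvd (monom 1 m - [:r:]))"

end

theory Submission
  imports Defs "HOL-Analysis.Harmonic_Numbers" "HOL-Computational_Algebra.Computational_Algebra"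
    "HOL-Number_Theory.Totient"
begin

text \<open>
  Let \<open>a\<close> be a root of \<open>f\<close>, with \<open>a\<^sup>m\<close> rational, and \<open>K = \<rat>(a)\<close>. The solutions of
  \<open>x\<^sup>m = 1\<close> in \<open>K\<close> are the \<open>n\<close>-th roots of unity for some \<open>n\<close>; let \<open>L \<subseteq> K\<close> be the field
  they generate and \<open>s = [K : L]\<close>. The constant term of the minimal polynomial of \<open>a\<close> over \<open>L\<close>
  is \<open>a\<^sup>s\<close> times a root of unity in \<open>K\<close>, so \<open>a\<^sup>s \<in> L\<close>. Conjugation in \<open>L\<close> multiplies \<open>a\<^sup>s\<close>
  by \<open>n\<close>-th roots of unity, so \<open>a\<close> to the power \<open>s n\<close> is rational. Since \<open>d = s \<phi>(n)\<close>
  and \<open>n \<le> 2 \<phi>(n)\<^sup>2\<close>, the minimal degree of a binomial multiple is at most \<open>2 d\<^sup>2\<close>.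
  This is below the stated bound for every \<open>d \<ge> 2\<close>.
\<close>

section \<open>Subrings and subfields of the complex numbers\<close>

locale complex_subring =
  fixes S :: "complex set"
  assumes one_closed [simp]: "1 \<in> S"
    and diff_closed [simp]: "x \<in> S \<Longrightarrow> y \<in> S \<Longrightarrow> x - y \<in> S"
    and mult_closed [simp]: "x \<in> S \<Longrightarrow> y \<in> S \<Longrightarrow> x * y \<in> S"
begin

lemma zero_closed [simp]: "0 \<in> S"
  using diff_closed[of 1 1] by simp

lemma uminus_closed [simp]: "x \<in> S \<Longrightarrow> - x \<in> S"
  using diff_closed[of 0 x] by simp

lemma add_closed [simp]: "x \<in> S \<Longrightarrow> y \<in> S \<Longrightarrow> x + y \<in> S"
  using diff_closed[of x "- y"] by simp

lemma power_closed [simp]: "x \<in> S \<Longrightarrow> x ^ k \<in> S"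
  by (induction k) auto

lemma sum_closed: "(\<And>i. i \<in> I \<Longrightarrow> h i \<in> S) \<Longrightarrow> sum h I \<in> S"
  by (induction I rule: infinite_finite_induct) auto

lemma of_nat_closed [simp]: "of_nat k \<in> S"
  by (induction k) auto

lemma of_int_closed [simp]: "of_int k \<in> S"
  by (cases k rule: int_diff_cases) simp

lemma Ints_subset: "\<int> \<subseteq> S"
  by (auto elim: Ints_cases)

end

locale complex_subfield = complex_subring +
  assumes inverse_closed [simp]: "x \<in> S \<Longrightarrow> inverse x \<in> S"
begin

lemma divide_closed [simp]: "x \<in> S \<Longrightarrow> y \<in> S \<Longrightarrow> x / y \<in> S"
  by (simp add: divide_inverse)

lemma Rats_subset: "\<rat> \<subseteq> S"
  by (auto elim!: Rats_cases')

end

interpretation Ints: complex_subring "\<int>"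
  by standard auto

interpretation Rats: complex_subfield "\<rat>"
  by standard auto

section \<open>Polynomials with coefficients in a subring\<close>

definition polys_over :: "complex set \<Rightarrow> complex poly set" where
  "polys_over S = {p. \<forall>i. coeff p i \<in> S}"

lemma polys_overI: "(\<And>i. coeff p i \<in> S) \<Longrightarrow> p \<in> polys_over S"
  by (simp add: polys_over_def)

lemma polys_over_mono: "S \<subseteq> T \<Longrightarrow> polys_over S \<subseteq> polys_over T"
  by (auto simp: polys_over_def)

lemma map_poly_of_rat_polys_over: "map_poly of_rat p \<in> polys_over \<rat>"
  by (simp add: polys_over_def coeff_map_poly)

context complex_subring
begin

lemma polys_over_add [simp]: "p \<in> polys_over S \<Longrightarrow> q \<in> polys_over S \<Longrightarrow> p + q \<in> polys_over S"
  by (simp add: polys_over_def)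

lemma polys_over_diff [simp]: "p \<in> polys_over S \<Longrightarrow> q \<in> polys_over S \<Longrightarrow> p - q \<in> polys_over S"
  by (simp add: polys_over_def)

lemma polys_over_uminus [simp]: "p \<in> polys_over S \<Longrightarrow> - p \<in> polys_over S"
  by (simp add: polys_over_def)

lemma polys_over_mult [simp]: "p \<in> polys_over S \<Longrightarrow> q \<in> polys_over S \<Longrightarrow> p * q \<in> polys_over S"
  by (simp add: polys_over_def coeff_mult sum_closed)

lemma polys_over_smult [simp]: "c \<in> S \<Longrightarrow> p \<in> polys_over S \<Longrightarrow> smult c p \<in> polys_over S"
  by (simp add: polys_over_def)

lemma polys_over_pCons [simp]: "c \<in> S \<Longrightarrow> p \<in> polys_over S \<Longrightarrow> pCons c p \<in> polys_over S"
  by (simp add: polys_over_def coeff_pCons split: nat.split)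

lemma polys_over_0 [simp]: "0 \<in> polys_over S"
  by (simp add: polys_over_def)

lemma polys_over_1 [simp]: "1 \<in> polys_over S"
  by (simp add: one_pCons)

lemma polys_over_monom [simp]: "c \<in> S \<Longrightarrow> monom c k \<in> polys_over S"
  by (simp add: polys_over_def)

lemma polys_over_power [simp]: "p \<in> polys_over S \<Longrightarrow> p ^ k \<in> polys_over S"
  by (induction k) auto

lemma polys_over_sum: "(\<And>i. i \<in> I \<Longrightarrow> h i \<in> polys_over S) \<Longrightarrow> sum h I \<in> polys_over S"
  by (induction I rule: infinite_finite_induct) auto

lemma polys_over_prod_mset:
  "(\<And>i. i \<in># I \<Longrightarrow> h i \<in> polys_over S) \<Longrightarrow> (\<Prod>i\<in>#I. h i) \<in> polys_over S"
  by (induction I) auto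

lemma coeff_polys_over [simp]: "p \<in> polys_over S \<Longrightarrow> coeff p i \<in> S"
  by (simp add: polys_over_def)

lemma poly_closed [simp]: "p \<in> polys_over S \<Longrightarrow> a \<in> S \<Longrightarrow> poly p a \<in> S"
  by (simp add: poly_altdef sum_closed)

text \<open>Long division: subtracting \<open>w * q\<close> cancels the leading term of
  \<open>p\<close>. As \<open>q\<close> is monic, no coefficient is inverted, so quotient and
  remainder keep their coefficients in \<open>S\<close>.\<close>

lemma monic_division:
  assumes "q \<in> polys_over S" "lead_coeff q = 1" "degree q > 0" "p \<in> polys_over S"
  shows "\<exists>u v. u \<in> polys_over S \<and> v \<in> polys_over S \<and> p = u * q + v \<and> degree v < degree q"
  using assms(4)
proof (induction "degree p" arbitrary: p rule: less_induct)
  case less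
  show ?case
  proof (cases "degree p < degree q")
    case True
    with less.prems show ?thesis
      by (intro exI[of _ 0] exI[of _ p]) auto
  next
    case False
    define w where "w = monom (lead_coeff p) (degree p - degree q)"
    have w: "w \<in> polys_over S"
      using less.prems by (simp add: w_def)
    have p0: "p \<noteq> 0" using False assms(3) by auto
    have lw: "lead_coeff w = lead_coeff p" "w \<noteq> 0" "degree w = degree p - degree q"
      using p0 by (auto simp: w_def degree_monom_eq)
    have q0: "q \<noteq> 0" using assms by auto
    have dwq: "degree (w * q) = degree p"
      using lw q0 False by (simp add: degree_mult_eq)
    have "coeff (w * q) (degree p) = lead_coeff p"
      using lead_coeff_mult[of w q] lw assms(2) dwq by simp
    moreover have "degree p > 0" using False assms(3) by simp
    ultimately have "degree (p - w * q) < degree p"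
      using dwq by (intro degree_lessI) (auto simp: coeff_eq_0 le_less)
    from less.hyps[OF this] obtain u v
      where "u \<in> polys_over S" "v \<in> polys_over S" "p - w * q = u * q + v" "degree v < degree q"
      using less.prems w assms(1) by (metis polys_over_diff polys_over_mult)
    thus ?thesis using w
      by (intro exI[of _ "u + w"] exI[of _ v]) (auto simp: algebra_simps)
  qed
qed

end

definition adjoin :: "complex set \<Rightarrow> complex \<Rightarrow> complex set" where
  "adjoin S a = (\<lambda>p. poly p a) ` polys_over S"

lemma adjoinI: "p \<in> polys_over S \<Longrightarrow> x = poly p a \<Longrightarrow> x \<in> adjoin S a"
  by (auto simp: adjoin_def)

lemma adjoinE:
  assumes "x \<in> adjoin S a"
  obtains p where "p \<in> polys_over S" "x = poly p a"
  using assms by (auto simp: adjoin_def)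

context complex_subring
begin

lemma complex_subring_adjoin: "complex_subring (adjoin S a)"
proof
  show "1 \<in> adjoin S a"
    by (rule adjoinI[of 1]) auto
next
  fix x y assume "x \<in> adjoin S a" "y \<in> adjoin S a"
  then obtain p q where "p \<in> polys_over S" "x = poly p a" "q \<in> polys_over S" "y = poly q a"
    by (elim adjoinE)
  thus "x - y \<in> adjoin S a" "x * y \<in> adjoin S a"
    by (auto intro: adjoinI[of "p - q"] adjoinI[of "p * q"])
qed

lemma subset_adjoin: "S \<subseteq> adjoin S a"
proof
  fix x assume "x \<in> S"
  thus "x \<in> adjoin S a" by (intro adjoinI[of "[:x:]"]) auto
qed

lemma generator_in_adjoin: "a \<in> adjoin S a"
  by (rule adjoinI[of "[:0, 1:]"]) auto

lemma adjoin_subset: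
  assumes "complex_subring T" "S \<subseteq> T" "a \<in> T"
  shows "adjoin S a \<subseteq> T"
proof
  interpret T: complex_subring T by fact
  fix x assume "x \<in> adjoin S a"
  then obtain p where "p \<in> polys_over S" "x = poly p a" by (elim adjoinE)
  thus "x \<in> T" using polys_over_mono[OF assms(2)] assms(3) by auto
qed

end

section \<open>Minimal polynomials\<close>

text \<open>Minimality is expressed by degrees rather than irreducibility, which makes remainders
  vanishing at \<open>a\<close> zero at once. The case \<open>p = 0\<close> is exempt because the
  zero polynomial has degree 0.\<close>

definition is_minpoly :: "complex set \<Rightarrow> complex \<Rightarrow> complex poly \<Rightarrow> bool" where
  "is_minpoly S a g \<longleftrightarrow> g \<in> polys_over S \<and> lead_coeff g = 1 \<and> poly g a = 0 \<and>
     (\<forall>p\<in>polys_over S. poly p a = 0 \<longrightarrow> p = 0 \<or> degree g \<le> degree p)"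

context complex_subfield
begin

lemma minpoly_exists:
  assumes "p \<in> polys_over S" "p \<noteq> 0" "poly p a = 0"
  shows "\<exists>g. is_minpoly S a g"
proof -
  define Q where "Q q \<longleftrightarrow> q \<in> polys_over S \<and> q \<noteq> 0 \<and> poly q a = 0" for q
  have "Q p" using assms by (simp add: Q_def)
  then obtain q where q: "Q q" "\<And>r. Q r \<Longrightarrow> degree q \<le> degree r"
    using ex_has_least_nat[of Q p degree] by blast
  define g where "g = smult (inverse (lead_coeff q)) q"
  have "g \<in> polys_over S" "lead_coeff g = 1" "poly g a = 0" "degree g = degree q"
    using q(1) by (auto simp: g_def Q_def)
  thus ?thesis using q(2) unfolding is_minpoly_def Q_def by metis
qed

lemma minpoly_degree_pos:
  assumes "is_minpoly S a g"
  shows "degree g > 0"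
proof (rule ccontr)
  assume "\<not> degree g > 0"
  then obtain c where "g = [:c:]" by (auto elim: degree_eq_zeroE)
  thus False using assms by (auto simp: is_minpoly_def)
qed

lemma minpoly_remainder_zero:
  assumes "is_minpoly S a g" "p \<in> polys_over S" "poly p a = 0" "degree p < degree g"
  shows "p = 0"
  using assms by (auto simp: is_minpoly_def not_le)

lemma minpoly_dvd:
  assumes "is_minpoly S a g" "p \<in> polys_over S" "poly p a = 0"
  shows "g dvd p"
proof -
  have g: "g \<in> polys_over S" "lead_coeff g = 1" "poly g a = 0"
    using assms(1) by (auto simp: is_minpoly_def)
  obtain u v where uv: "u \<in> polys_over S" "v \<in> polys_over S" "p = u * g + v" "degree v < degree g"
    using monic_division[OF g(1,2) minpoly_degree_pos[OF assms(1)] assms(2)] by blast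
  have "v = 0"
    using uv g assms(3) by (intro minpoly_remainder_zero[OF assms(1)]) auto
  thus ?thesis using uv by simp
qed

text \<open>Euclid's algorithm as a recursion, used to make \<open>adjoin S a\<close> a field.
  Dividing \<open>g\<close> by \<open>p\<close> leaves a remainder of lower degree whose value at
  \<open>a\<close> is a multiple of \<open>poly p a\<close>; an inverse of the former yields one of
  the latter.\<close>

lemma minpoly_inverse:
  assumes "is_minpoly S a g" "p \<in> polys_over S" "poly p a \<noteq> 0" "degree p < degree g"
  shows "\<exists>w\<in>polys_over S. poly w a * poly p a = 1"
  using assms(2-4)
proof (induction "degree p" arbitrary: p rule: less_induct)
  case less
  have g: "g \<in> polys_over S" "lead_coeff g = 1" "poly g a = 0"
    using assms(1) by (auto simp: is_minpoly_def)
  have p0: "p \<noteq> 0" using less.prems by auto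
  show ?case
  proof (cases "degree p = 0")
    case True
    then obtain c where c: "p = [:c:]" by (auto elim: degree_eq_zeroE)
    have "c \<in> S" using coeff_polys_over[OF less.prems(1), of 0] c by simp
    thus ?thesis using c p0 by (intro bexI[of _ "[:inverse c:]"]) auto
  next
    case False
    define c where "c = lead_coeff p"
    have c: "c \<in> S" "c \<noteq> 0" using less.prems p0 by (auto simp: c_def)
    define q where "q = smult (inverse c) p"
    have q: "q \<in> polys_over S" "lead_coeff q = 1" "degree q = degree p" "poly q a \<noteq> 0"
      using c less.prems by (auto simp: q_def c_def)
    obtain u v where uv: "u \<in> polys_over S" "v \<in> polys_over S" "g = u * q + v" "degree v < degree q"
      using monic_division[OF q(1,2) _ g(1)] False q(3) by auto
    have eq: "poly v a = - (poly u a * poly q a)"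
      using arg_cong[OF uv(3), of "\<lambda>r. poly r a"] g(3) by (simp add: eq_neg_iff_add_eq_0 add.commute)
    \<comment> \<open>Otherwise \<open>v = 0\<close> and \<open>g = u * q\<close>, so
      \<open>u\<close> would be a nonzero polynomial of smaller degree than \<open>g\<close>
      vanishing at \<open>a\<close>.\<close>
    have "poly v a \<noteq> 0"
    proof
      assume va: "poly v a = 0"
      hence "v = 0" using uv q less.prems by (intro minpoly_remainder_zero[OF assms(1)]) auto
      hence "g = u * q" using uv by simp
      moreover from this have "u \<noteq> 0" "q \<noteq> 0" using g by auto
      ultimately have "degree u < degree g" using False q(3) by (simp add: degree_mult_eq)
      moreover have "poly u a = 0" using eq va q by auto
      ultimately have "u = 0" using uv by (intro minpoly_remainder_zero[OF assms(1)]) auto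
      thus False using \<open>u \<noteq> 0\<close> by simp
    qed
    then obtain w where w: "w \<in> polys_over S" "poly w a * poly v a = 1"
      using less.hyps[of v] uv q less.prems by force
    have "poly (smult (- inverse c) (w * u)) a * poly p a = 1"
      using w(2) eq by (simp add: q_def algebra_simps)
    thus ?thesis using w uv c by (intro bexI[of _ "smult (- inverse c) (w * u)"]) auto
  qed
qed

lemma minpoly_reduce:
  assumes "is_minpoly S a g" "p \<in> polys_over S"
  obtains q where "q \<in> polys_over S" "poly q a = poly p a" "degree q < degree g"
proof -
  have g: "g \<in> polys_over S" "lead_coeff g = 1" "poly g a = 0"
    using assms(1) by (auto simp: is_minpoly_def)
  obtain u v where uv: "u \<in> polys_over S" "v \<in> polys_over S" "p = u * g + v" "degree v < degree g"
    using monic_division[OF g(1,2) minpoly_degree_pos[OF assms(1)] assms(2)] by blast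
  thus ?thesis using that[of v] g by auto
qed

lemma complex_subfield_adjoin:
  assumes "is_minpoly S a g"
  shows "complex_subfield (adjoin S a)"
proof -
  interpret A: complex_subring "adjoin S a" by (rule complex_subring_adjoin)
  show ?thesis
  proof
    fix x assume "x \<in> adjoin S a"
    then obtain p where p: "p \<in> polys_over S" "x = poly p a" by (elim adjoinE)
    then obtain q where q: "q \<in> polys_over S" "x = poly q a" "degree q < degree g"
      using minpoly_reduce[OF assms] by metis
    show "inverse x \<in> adjoin S a"
    proof (cases "x = 0")
      case False
      then obtain w where "w \<in> polys_over S" "poly w a * x = 1"
        using minpoly_inverse[OF assms q(1)] q by auto
      moreover from this have "inverse x = poly w a"
        using False by (simp add: field_simps)
      ultimately show ?thesis by (auto intro: adjoinI)
    qed auto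
  qed
qed

end

section \<open>Cyclotomic irreducibility\<close>

text \<open>With \<open>x = a / b\<close> in lowest terms, every power of \<open>b\<close> divides
  the fixed number \<open>D\<close>, which forces \<open>b = 1\<close>.\<close>

lemma rational_with_bounded_power_denominators:
  fixes x :: complex and D :: int
  assumes "x \<in> \<rat>" "D > 0" "\<And>k. of_int D * x ^ k \<in> \<int>"
  shows "x \<in> \<int>"
proof -
  obtain a b :: int where ab: "b > 0" "coprime a b" "x = of_int a / of_int b"
    using assms(1) by (auto elim: Rats_cases')
  have dvd: "b ^ k dvd D" for k
  proof -
    obtain c where c: "of_int D * x ^ k = of_int c"
      using assms(3)[of k] by (auto elim: Ints_cases)
    hence "(of_int (D * a ^ k) :: complex) = of_int (c * b ^ k)"
      using ab(1) by (simp add: ab(3) field_simps)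
    hence "D * a ^ k = c * b ^ k" by (simp only: of_int_eq_iff)
    hence "b ^ k dvd D * a ^ k" by simp
    moreover have "coprime (b ^ k) (a ^ k)" using ab(2) by (simp add: coprime_commute)
    ultimately show ?thesis by (simp add: coprime_dvd_mult_left_iff)
  qed
  have "b = 1"
  proof (rule ccontr)
    assume "b \<noteq> 1"
    hence "b \<ge> 2" using ab(1) by simp
    have "D < 2 ^ nat D" 
      using assms(2) of_nat_less_two_power[of "nat D", where ?'a = int] by simp
    also have "\<dots> \<le> b ^ nat D" using \<open>b \<ge> 2\<close> by (intro power_mono) auto
    finally show False using zdvd_imp_le[OF dvd[of "nat D"] assms(2)] by simp
  qed
  thus ?thesis using ab by simp
qed

lemma common_denominator:
  fixes h :: "nat \<Rightarrow> complex"
  assumes "\<And>i. i < n \<Longrightarrow> h i \<in> \<rat>"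
  shows "\<exists>D::int. D > 0 \<and> (\<forall>i<n. of_int D * h i \<in> \<int>)"
  using assms
proof (induction n)
  case (Suc n)
  then obtain D :: int where D: "D > 0" "\<forall>i<n. of_int D * h i \<in> \<int>" by auto
  obtain a b :: int where ab: "b > 0" "h n = of_int a / of_int b"
    using Suc.prems[of n] by (auto elim: Rats_cases')
  have "of_int (D * b) * h i \<in> \<int>" if "i < Suc n" for i
  proof (cases "i = n")
    case True
    thus ?thesis using ab by simp
  next
    case False
    hence "of_int D * h i \<in> \<int>" using D that by simp
    hence "of_int b * (of_int D * h i) \<in> \<int>" by (rule Ints_mult[OF Ints_of_int])
    thus ?thesis by (simp add: mult_ac)
  qed
  thus ?case using D(1) ab(1) by (intro exI[of _ "D * b"]) auto
qed (auto intro: exI[of _ 1])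

lemma poly_dvd_root: "g dvd p \<Longrightarrow> poly g a = 0 \<Longrightarrow> poly p a = 0"
  by (auto elim!: dvdE)

lemma power_mod_root_of_unity:
  fixes z :: "'a::monoid_mult"
  assumes "z ^ n = 1"
  shows "z ^ (i mod n) = z ^ i"
proof -
  have "z ^ i = z ^ (n * (i div n) + i mod n)" by simp
  also have "\<dots> = z ^ (i mod n)" by (simp only: power_add power_mult assms power_one mult_1)
  finally show ?thesis by simp
qed

lemma root_of_unity_minpoly_exists:
  assumes "n > 0" "z ^ n = (1::complex)"
  shows "\<exists>g. is_minpoly \<rat> z g"
proof (rule Rats.minpoly_exists[of "monom 1 n - 1"])
  show "monom 1 n - 1 \<noteq> (0 :: complex poly)"
  proof
    assume "monom 1 n - 1 = (0 :: complex poly)"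
    from arg_cong[OF this, of "\<lambda>p. coeff p n"] show False
      using assms(1) by (simp add: coeff_1)
  qed
qed (use assms in \<open>auto simp: poly_monom\<close>)

text \<open>
  The constant term of the remainder modulo the minimal polynomial is a \<open>\<rat>\<close>-linear functional
  fixing \<open>\<rat>\<close>; its values on \<open>\<int>[z]\<close> have a common denominator, so a rational number in
  \<open>\<int>[z]\<close> has powers with bounded denominators.
\<close>

lemma adjoin_Ints_root_of_unity_rational:
  assumes "n > 0" "z ^ n = 1" "x \<in> adjoin \<int> z" "x \<in> \<rat>"
  shows "x \<in> \<int>"
proof -
  obtain g where g: "is_minpoly \<rat> z g"
    using root_of_unity_minpoly_exists[OF assms(1,2)] by blast
  have "\<forall>i. \<exists>r. r \<in> polys_over \<rat> \<and> poly r z = z ^ i \<and> degree r < degree g"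
  proof
    fix i
    show "\<exists>r. r \<in> polys_over \<rat> \<and> poly r z = z ^ i \<and> degree r < degree g"
      using Rats.minpoly_reduce[OF g, of "monom 1 i"] by (auto simp: poly_monom)
  qed
  then obtain r where r: "\<And>i. r i \<in> polys_over \<rat>" "\<And>i. poly (r i) z = z ^ i"
      "\<And>i. degree (r i) < degree g"
    by metis
  \<comment> \<open>Powers of \<open>z\<close> repeat with period \<open>n\<close>, so a common
    denominator for the first \<open>n\<close> remainders serves all powers.\<close>
  obtain D :: int where D: "D > 0" "\<forall>i<n. of_int D * coeff (r i) 0 \<in> \<int>"
    using common_denominator[of n "\<lambda>i. coeff (r i) 0"] r(1) by auto
  have bound: "of_int D * y \<in> \<int>" if y: "y \<in> adjoin \<int> z" "y \<in> \<rat>" for y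
  proof -
    obtain p where p: "p \<in> polys_over \<int>" "y = poly p z" using y(1) by (elim adjoinE)
    \<comment> \<open>\<open>T\<close> represents \<open>p\<close> modulo \<open>g\<close>. It takes
      the rational value \<open>y\<close> at \<open>z\<close> and has degree below that of
      \<open>g\<close>, so it must be the constant \<open>y\<close>.\<close>
    define T where "T = (\<Sum>i\<le>degree p. smult (coeff p i) (r (i mod n)))"
    have "T - [:y:] = 0"
    proof (rule Rats.minpoly_remainder_zero[OF g])
      have "coeff p i \<in> \<rat>" for i
        using p(1) Ints.coeff_polys_over Ints_subset_Rats by blast
      thus "T - [:y:] \<in> polys_over \<rat>"
        using y(2) r(1) by (auto simp: T_def intro!: Rats.polys_over_diff Rats.polys_over_sum)
      show "poly (T - [:y:]) z = 0"
        using power_mod_root_of_unity[OF assms(2)]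
        by (simp add: T_def poly_sum r(2) p(2) poly_altdef[of p])
      have "degree T < degree g"
        unfolding T_def using Rats.minpoly_degree_pos[OF g]
        by (intro degree_sum_less) (auto intro!: le_less_trans[OF degree_smult_le] r(3))
      thus "degree (T - [:y:]) < degree g"
        using Rats.minpoly_degree_pos[OF g] by (intro degree_diff_less) auto
    qed
    hence "y = coeff T 0" by (metis eq_iff_diff_eq_0 coeff_pCons_0)
    hence "of_int D * y = (\<Sum>i\<le>degree p. coeff p i * (of_int D * coeff (r (i mod n)) 0))"
      by (simp add: T_def coeff_sum sum_distrib_left mult_ac)
    also have "\<dots> \<in> \<int>"
      using p(1) D(2) assms(1) by (intro Ints.sum_closed Ints.mult_closed[of "coeff p i" for i]) auto
    finally show ?thesis .
  qed
  interpret A: complex_subring "adjoin \<int> z" by (rule Ints.complex_subring_adjoin)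
  show ?thesis
    using rational_with_bounded_power_denominators[OF assms(4) D(1)] bound assms(3,4) by simp
qed

text \<open>From \<open>n = \<Sum>\<^sub>k (1 - w\<^sup>k)\<close>, summed over \<open>k < n\<close>.\<close>

lemma one_minus_root_of_unity_dvd:
  assumes "w ^ n = (1::complex)" "w \<noteq> 1" "w \<in> R" "complex_subring R"
  shows "\<exists>c\<in>R. (1 - w) * c = of_nat n"
proof -
  interpret R: complex_subring R by fact
  have "(1 - w) * (\<Sum>k<n. w ^ k) = 0"
    using assms(1) by (simp add: sum_gp_strict)
  hence "(\<Sum>k<n. w ^ k) = 0" using assms(2) by simp
  hence "of_nat n = (\<Sum>k<n. 1 - w ^ k)" by (simp add: sum_subtractf)
  also have "\<dots> = (\<Sum>k<n. (1 - w) * (\<Sum>l<k. w ^ l))"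
    by (simp add: one_diff_power_eq)
  also have "\<dots> = (1 - w) * (\<Sum>k<n. \<Sum>l<k. w ^ l)"
    by (simp add: sum_distrib_left)
  finally show ?thesis
    using assms(3) by (intro bexI[of _ "\<Sum>k<n. \<Sum>l<k. w ^ l"]) (auto intro!: R.sum_closed)
qed

section \<open>The Frobenius congruence modulo a prime\<close>

text \<open>The inner binomial coefficients are multiples of \<open>p\<close>. The cofactor is
  written out so that its integrality can be read off later.\<close>

lemma binomial_prime_power:
  fixes u v :: "'a::comm_ring_1"
  assumes "prime p"
  shows "(u + v) ^ p = u ^ p + v ^ p +
    of_nat p * (\<Sum>k\<in>{0<..<p}. of_nat ((p choose k) div p) * u ^ k * v ^ (p - k))"
proof -
  have p: "p > 0" using assms prime_gt_0_nat by blast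
  have "(u + v) ^ p = (\<Sum>k\<le>p. of_nat (p choose k) * u ^ k * v ^ (p - k))"
    by (rule binomial_ring)
  also have "{..p} = {0, p} \<union> {0<..<p}" using p by auto
  also have "(\<Sum>k\<in>\<dots>. of_nat (p choose k) * u ^ k * v ^ (p - k)) =
      u ^ p + v ^ p + (\<Sum>k\<in>{0<..<p}. of_nat (p choose k) * u ^ k * v ^ (p - k))"
    using p by (subst sum.union_disjoint) (auto simp: add.commute)
  also have "(\<Sum>k\<in>{0<..<p}. of_nat (p choose k) * u ^ k * v ^ (p - k)) =
      of_nat p * (\<Sum>k\<in>{0<..<p}. of_nat ((p choose k) div p) * u ^ k * v ^ (p - k))"
    unfolding sum_distrib_left
  proof (intro sum.cong refl)
    fix k assume "k \<in> {0<..<p}"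
    hence "p dvd (p choose k)" using assms by (intro dvd_choose_prime) auto
    hence "of_nat (p choose k) = (of_nat p * of_nat ((p choose k) div p) :: 'a)"
      by (metis dvd_mult_div_cancel of_nat_mult)
    thus "of_nat (p choose k) * u ^ k * v ^ (p - k) =
      of_nat p * (of_nat ((p choose k) div p) * u ^ k * v ^ (p - k))"
      by (simp add: mult_ac)
  qed
  finally show ?thesis .
qed

text \<open>Fermat's little theorem, by moving from 0 in both directions: \<open>(c + 1) ^ p\<close>
  is congruent to \<open>c ^ p + 1\<close> modulo \<open>p\<close>.\<close>

lemma prime_dvd_power_minus_self:
  fixes c :: int
  assumes "prime p"
  shows "int p dvd c ^ p - c"
proof -
  have step: "int p dvd (c + 1) ^ p - (c + 1) \<longleftrightarrow> int p dvd c ^ p - c" for c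
  proof -
    obtain r where "(c + 1) ^ p = c ^ p + 1 + int p * r"
      using binomial_prime_power[OF assms, of c 1] by auto
    hence "(c + 1) ^ p - (c + 1) = (c ^ p - c) + int p * r" by simp
    thus ?thesis by (metis dvd_add_left_iff dvd_triv_left)
  qed
  show ?thesis
  proof (induction c rule: int_induct[of _ 0])
    case base
    show ?case using prime_gt_0_nat[OF assms] by (simp add: power_0_left)
  next
    case (step1 c)
    thus ?case using step by simp
  next
    case (step2 c)
    thus ?case using step[of "c - 1"] by simp
  qed
qed

text \<open>Induction on the coefficients: the binomial congruence splits off the constant
  coefficient \<open>a\<close>, and Fermat's little theorem exchanges \<open>a\<close> for
  \<open>a ^ p\<close> modulo \<open>p\<close>.\<close>

lemma int_poly_frobenius:
  assumes "prime p" "q \<in> polys_over \<int>"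
  shows "\<exists>r\<in>polys_over \<int>. \<forall>x. poly q (x ^ p) = poly q x ^ p + of_nat p * poly r x"
proof -
  show ?thesis using assms(2)
  proof (induction q rule: pCons_induct)
    case 0
    show ?case using prime_gt_0_nat[OF assms(1)] by (intro bexI[of _ 0]) (auto simp: power_0_left)
  next
    case (pCons a q)
    have "coeff q i \<in> \<int>" for i
      using Ints.coeff_polys_over[OF pCons.prems, of "Suc i"] by simp
    hence q: "q \<in> polys_over \<int>" by (rule polys_overI)
    have a: "a \<in> \<int>" using Ints.coeff_polys_over[OF pCons.prems, of 0] by simp
    obtain r where r: "r \<in> polys_over \<int>"
        "\<forall>x. poly q (x ^ p) = poly q x ^ p + of_nat p * poly r x"
      using pCons.IH q by blast
    define s where "s =
      (\<Sum>k\<in>{0<..<p}. of_nat ((p choose k) div p) * [:a:] ^ k * ([:0, 1:] * q) ^ (p - k))"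
    have s: "s \<in> polys_over \<int>"
        "([:a:] + [:0, 1:] * q) ^ p = [:a:] ^ p + ([:0, 1:] * q) ^ p + of_nat p * s"
      using a q binomial_prime_power[OF assms(1), of "[:a:]" "[:0, 1:] * q"] unfolding s_def
      by (auto simp: of_nat_poly simp del: mult_pCons_left mult_pCons_right
          intro!: Ints.polys_over_sum Ints.polys_over_smult Ints.polys_over_mult Ints.polys_over_power)
    have "\<exists>b\<in>\<int>. a = a ^ p + of_nat p * b"
    proof -
      obtain c where c: "a = of_int c" using a by (elim Ints_cases)
      have "int p dvd c ^ p - c"
        using assms(1) by (rule prime_dvd_power_minus_self)
      then obtain e where "c ^ p - c = int p * e" by (elim dvdE)
      hence "c = c ^ p + int p * (- e)" by simp
      hence "a = a ^ p + of_nat p * of_int (- e)" unfolding c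
        by (metis of_int_add of_int_mult of_int_of_nat_eq of_int_power)
      thus ?thesis by (intro bexI[of _ "of_int (- e)"]) auto
    qed
    then obtain b where b: "b \<in> \<int>" "a = a ^ p + of_nat p * b" by blast
    \<comment> \<open>The error term collects \<open>b\<close> from Fermat's theorem and
      \<open>monom 1 p * r\<close> from the induction hypothesis, minus the mixed terms
      \<open>s\<close> of the \<open>p\<close>-th power.\<close>
    have "poly (pCons a q) (x ^ p) =
        poly (pCons a q) x ^ p + of_nat p * poly ([:b:] + monom 1 p * r - s) x" for x
    proof -
      have "poly (pCons a q) x ^ p = a ^ p + (x * poly q x) ^ p + of_nat p * poly s x"
        using arg_cong[OF s(2), of "\<lambda>t. poly t x"] by (simp add: of_nat_poly)
      moreover have "poly (pCons a q) (x ^ p) = a + x ^ p * (poly q x ^ p + of_nat p * poly r x)"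
        using r(2) by simp
      ultimately show ?thesis
        by (subst (asm) (2) b(2)) (simp add: algebra_simps power_mult_distrib poly_monom)
    qed
    moreover have "[:b:] + monom 1 p * r - s \<in> polys_over \<int>" using b r s by simp
    ultimately show ?case by blast
  qed
qed

section \<open>Conjugates of a root of unity\<close>

lemma monic_complex_poly_decompose:
  assumes "lead_coeff (g :: complex poly) = 1"
  shows "g = (\<Prod>a\<in>#proots g. [:-a, 1:])"
  using complex_poly_decompose_multiset[of g] assms by simp

lemma poly_prod_mset_linear:
  "poly (\<Prod>a\<in>#A. [:-a, 1:]) x = (\<Prod>a\<in>#A. x - a :: complex)"
  by (induction A) (auto simp: algebra_simps)

lemma minpoly_root_of_unity_roots:
  assumes "z ^ n = 1" "is_minpoly \<rat> z g" "poly g a = 0"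
  shows "a ^ n = 1"
proof -
  have "g dvd monom 1 n - 1"
    using assms(1) by (intro Rats.minpoly_dvd[OF assms(2)]) (auto simp: poly_monom)
  hence "poly (monom 1 n - 1) a = 0" using assms(3) by (rule poly_dvd_root)
  thus ?thesis by (simp add: poly_monom)
qed

lemma roots_of_unity_powers:
  assumes "n > 0" "w ^ n = (1::complex)"
  shows "\<exists>i<n. w = cis (2 * pi / real n) ^ i"
proof -
  have "w \<in> (\<lambda>k. cis (2 * pi * real k / real n)) ` {..<n}"
    using bij_betw_imp_surj_on[OF Complex.bij_betw_roots_unity[OF assms(1)]] assms(2) by auto
  thus ?thesis by (auto simp: Complex.DeMoivre mult_ac)
qed

lemma cis_root_of_unity: "n > 0 \<Longrightarrow> cis (2 * pi / real n) ^ n = 1"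
  by (simp add: Complex.DeMoivre cis_2pi)

lemma root_of_unity_in_adjoin:
  assumes "complex_subring S" "n > 0" "w ^ n = 1"
  shows "w \<in> adjoin S (cis (2 * pi / real n))"
proof -
  interpret S: complex_subring S by fact
  interpret A: complex_subring "adjoin S (cis (2 * pi / real n))"
    by (rule S.complex_subring_adjoin)
  show ?thesis
    using roots_of_unity_powers[OF assms(2,3)] S.generator_in_adjoin by auto
qed

text \<open>
  If the minimal polynomial \<open>g\<close> of \<open>z\<close> did not vanish at \<open>z\<^sup>p\<close>, then \<open>g(z\<^sup>p)\<close> would be a product
  of differences of roots of unity, hence a divisor of a power of \<open>n\<close>; but it is divisible
  by \<open>p\<close> because \<open>g(x\<^sup>p) \<equiv> g(x)\<^sup>p\<close> modulo \<open>p\<close>.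
\<close>

lemma conjugate_prime_power:
  assumes n: "n > 0" and z: "z ^ n = 1" and p: "prime p" "\<not> p dvd n"
    and P: "P \<in> polys_over \<rat>" "poly P z = 0"
  shows "poly P (z ^ p) = 0"
proof -
  define R where "R = adjoin \<int> (cis (2 * pi / real n))"
  interpret R: complex_subring R unfolding R_def by (rule Ints.complex_subring_adjoin)
  have unity: "w \<in> R" if "w ^ n = 1" for w
    unfolding R_def using Ints.complex_subring_axioms n that by (rule root_of_unity_in_adjoin)
  have R_rat: "x \<in> \<int>" if "x \<in> R" "x \<in> \<rat>" for x
    using adjoin_Ints_root_of_unity_rational[OF n cis_root_of_unity[OF n]] that by (simp add: R_def)
  obtain g where g: "is_minpoly \<rat> z g"
    using root_of_unity_minpoly_exists[OF n z] by blast
  have monic: "lead_coeff g = 1" and g_rat: "g \<in> polys_over \<rat>" and gz: "poly g z = 0"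
    using g by (auto simp: is_minpoly_def)
  have g0: "g \<noteq> 0" using monic by auto
  have root: "a ^ n = 1" if "a \<in># proots g" for a
    using that g0 minpoly_root_of_unity_roots[OF z g] by simp
  \<comment> \<open>A substitute for Gauss's lemma: the roots of \<open>g\<close> are roots of
    unity, so its coefficients lie in \<open>R\<close>; being rational, they are integers.\<close>
  have "g \<in> polys_over R"
    by (subst monic_complex_poly_decompose[OF monic], rule R.polys_over_prod_mset)
       (use root unity in auto)
  hence g_int: "g \<in> polys_over \<int>"
    using g_rat R_rat by (intro polys_overI) auto
  obtain r where r: "r \<in> polys_over \<int>"
      "\<And>x. poly g (x ^ p) = poly g x ^ p + of_nat p * poly r x"
    using int_poly_frobenius[OF p(1) g_int] by blast
  have "poly g (z ^ p) = of_nat p * poly r z"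
    using r(2)[of z] gz prime_gt_0_nat[OF p(1)] by (simp add: power_0_left)
  have "poly g (z ^ p) = 0"
  proof (rule ccontr)
    assume nz: "poly g (z ^ p) \<noteq> 0"
    have dvd: "\<exists>c\<in>R. (z ^ p - a) * c = of_nat n" if a: "a \<in># proots g" for a
    proof -
      \<comment> \<open>This is \<open>a\<close> divided by \<open>z ^ p\<close>;
        \<open>z ^ (n - 1)\<close> serves as the inverse of \<open>z\<close>, since \<open>R\<close>
        is only known to be a ring.\<close>
      define w where "w = a * (z ^ (n - 1)) ^ p"
      have zz: "z * z ^ (n - 1) = 1" using z n by (simp flip: power_Suc)
      hence zzp: "z ^ p * (z ^ (n - 1)) ^ p = 1" by (metis power_mult_distrib power_one)
      hence eq: "z ^ p - a = z ^ p * (1 - w)"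
        by (simp add: w_def algebra_simps)
      have "z ^ p \<noteq> a" using a g0 nz by auto
      hence "w \<noteq> 1" using eq by auto
      moreover have "w ^ n = 1"
        using root[OF a] z unfolding w_def 
        by (simp add: power_mult_distrib) (metis power_mult mult.commute power_one)
      ultimately obtain c where c: "c \<in> R" "(1 - w) * c = of_nat n"
        using one_minus_root_of_unity_dvd[OF _ _ unity R.complex_subring_axioms] by blast
      have "(z ^ p - a) * (c * (z ^ (n - 1)) ^ p) = (z ^ p * (z ^ (n - 1)) ^ p) * ((1 - w) * c)"
        unfolding eq by (simp add: mult_ac)
      also have "\<dots> = of_nat n" using zzp c(2) by simp
      finally show ?thesis using c(1) unity[OF z]
        by (intro bexI[of _ "c * (z ^ (n - 1)) ^ p"]) auto
    qed
    have "\<exists>c\<in>R. (\<Prod>a\<in>#A. z ^ p - a) * c = of_nat (n ^ size A)" if "A \<subseteq># proots g" for A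
      using that
    proof (induction A)
      case empty
      show ?case by (intro bexI[of _ 1]) auto
    next
      case (add a A)
      have "A \<subseteq># proots g" using add.prems
        by (meson mset_subset_eq_insertD subset_mset.less_imp_le)
      then obtain c where c: "c \<in> R" "(\<Prod>a\<in>#A. z ^ p - a) * c = of_nat (n ^ size A)"
        using add.IH by blast
      have "a \<in># proots g" using add.prems by (simp add: insert_subset_eq_iff)
      then obtain d where d: "d \<in> R" "(z ^ p - a) * d = of_nat n" using dvd by blast
      have "(\<Prod>a\<in>#add_mset a A. z ^ p - a) * (c * d) =
          ((\<Prod>a\<in>#A. z ^ p - a) * c) * ((z ^ p - a) * d)"
        by (simp add: mult_ac)
      also have "\<dots> = of_nat (n ^ size (add_mset a A))"
        unfolding c(2) d(2) by simp
      finally show ?case using c(1) d(1) by (intro bexI[of _ "c * d"]) auto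
    qed
    from this[of "proots g"] obtain c where c': "c \<in> R"
        "(\<Prod>a\<in>#proots g. z ^ p - a) * c = of_nat (n ^ size (proots g))"
      by auto
    have "poly g (z ^ p) = (\<Prod>a\<in>#proots g. z ^ p - a)"
      using arg_cong[OF monic_complex_poly_decompose[OF monic], of "\<lambda>h. poly h (z ^ p)"]
      by (simp only: poly_prod_mset_linear)
    hence c: "c \<in> R" "poly g (z ^ p) * c = of_nat (n ^ size (proots g))"
      using c' by simp_all
    \<comment> \<open>\<open>x\<close> is a power of \<open>n\<close> divided by \<open>p\<close>,
      hence rational, and it lies in \<open>R\<close>. So it is an integer, and \<open>p\<close>
      divides a power of \<open>n\<close>.\<close>
    define x where "x = poly r z * c"
    have px: "of_nat p * x = of_nat (n ^ size (proots g))"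
      using c(2) \<open>poly g (z ^ p) = of_nat p * poly r z\<close> by (simp add: x_def mult_ac)
    have p0: "(of_nat p :: complex) \<noteq> 0" using prime_gt_0_nat[OF p(1)] by simp
    have "x = of_nat (n ^ size (proots g)) / of_nat p"
      using px p0 by (simp add: field_simps)
    hence "x \<in> \<rat>" by (metis Rats_divide Rats_of_nat)
    moreover have "poly r z \<in> R"
      using polys_over_mono[OF R.Ints_subset] r(1) unity[OF z] by auto
    hence "x \<in> R" using c(1) by (simp add: x_def)
    ultimately have "x \<in> \<int>" by (intro R_rat)
    then obtain y where "x = of_int y" by (elim Ints_cases)
    hence "(of_int (int p * y) :: complex) = of_int (int (n ^ size (proots g)))"
      using px by simp
    hence "int p * y = int (n ^ size (proots g))" by (simp only: of_int_eq_iff)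
    hence "p dvd n ^ size (proots g)" by (metis dvd_triv_left int_dvd_int_iff)
    thus False using p prime_dvd_power by blast
  qed
  moreover have "g dvd P" by (rule Rats.minpoly_dvd[OF g P])
  ultimately show ?thesis by (rule poly_dvd_root[rotated])
qed

text \<open>Prime factors of \<open>k\<close> are peeled off one at a time. Each replaces
  \<open>z\<close> by \<open>z ^ p\<close>, again an \<open>n\<close>-th root of unity and a root of
  \<open>P\<close>, so \<open>z\<close> varies in the induction.\<close>

lemma conjugate_coprime_power:
  assumes "n > 0" "z ^ n = 1" "coprime k n" "k > 0" "P \<in> polys_over \<rat>" "poly P z = 0"
  shows "poly P (z ^ k) = 0"
  using assms(2-4,6)
proof (induction k arbitrary: z rule: prime_divisors_induct)
  case (factor p k)
  have "\<not> p dvd n" using factor by (metis coprime_mult_left_iff not_coprimeI dvd_refl not_prime_unit)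
  hence "poly P (z ^ p) = 0"
    using conjugate_prime_power[OF assms(1) factor.prems(1) factor.hyps(1) _ assms(5)]
      factor.prems by simp
  moreover have "(z ^ p) ^ n = 1"
    using factor.prems(1) by (metis mult.commute power_mult power_one)
  ultimately have "poly P ((z ^ p) ^ k) = 0"
    using factor by (intro factor.IH) auto
  thus ?case by (simp add: power_mult)
qed auto

text \<open>The powers of \<open>cis (2 * pi / real n)\<close> with exponent coprime to
  \<open>n\<close> are distinct roots of \<open>g\<close>. This is the substance of the
  irreducibility of cyclotomic polynomials.\<close>

lemma totient_le_degree_minpoly:
  assumes "n > 0" "is_minpoly \<rat> (cis (2 * pi / real n)) g"
  shows "totient n \<le> degree g"
proof -
  define z where "z = cis (2 * pi / real n)"
  have g: "g \<in> polys_over \<rat>" "poly g z = 0" "g \<noteq> 0"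
    using assms(2) by (auto simp: is_minpoly_def z_def)
  have inj: "inj_on (\<lambda>k. z ^ k) {..<n}"
    using bij_betw_imp_inj_on[OF Complex.bij_betw_roots_unity[OF assms(1)]]
    by (simp add: z_def Complex.DeMoivre mult_ac)
  have inj': "inj_on (\<lambda>k. z ^ k) (totatives n)"
  proof (rule inj_onI)
    fix i j assume ij: "i \<in> totatives n" "j \<in> totatives n" "z ^ i = z ^ j"
    have "z ^ n = 1" unfolding z_def using assms(1) by (rule cis_root_of_unity)
    \<comment> \<open>Totatives range over 1 to \<open>n\<close>, while \<open>inj\<close> covers
      exponents below \<open>n\<close>; the exponent \<open>n\<close> is therefore treated as
      residue 0.\<close>
    hence "z ^ (i mod n) = z ^ (j mod n)" using ij(3) by (simp add: power_mod_root_of_unity)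
    hence "i mod n = j mod n" using inj_onD[OF inj] assms(1) by simp
    moreover have "i > 0" "i \<le> n" "j > 0" "j \<le> n" using ij by (auto simp: in_totatives_iff)
    ultimately show "i = j" by (cases "i = n"; cases "j = n") auto
  qed
  have "totient n = card ((\<lambda>k. z ^ k) ` totatives n)"
    using inj' by (simp add: totient_def card_image)
  also have "\<dots> \<le> card {x. poly g x = 0}"
  proof (intro card_mono image_subsetI CollectI)
    fix k assume "k \<in> totatives n"
    thus "poly g (z ^ k) = 0"
      using g cis_root_of_unity[OF assms(1)] assms(1) unfolding z_def
      by (intro conjugate_coprime_power[of n]) (auto simp: in_totatives_iff)
  qed (use g poly_roots_finite in auto)
  also have "\<dots> \<le> degree g" using g by (intro card_poly_roots_bound)
  finally show ?thesis .
qed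

section \<open>A lower bound for the totient\<close>

text \<open>It comes down to \<open>p \<le> (p - 1) ^ 2\<close>, which holds from 3 on; at 2 the
  extra factor 2 compensates.\<close>

lemma prime_power_le_totient_square:
  assumes "prime p" "k > 0"
  shows "p ^ k \<le> (if p = 2 then 2 else 1) * totient (p ^ k) ^ 2"
proof -
  obtain j where k: "k = Suc j" using assms(2) gr0_implies_Suc by blast
  have t: "totient (p ^ k) = p ^ j * (p - 1)"
    using totient_prime_power_Suc[OF assms(1), of j] by (simp add: k)
  have pj: "p ^ j \<ge> 1" using prime_gt_0_nat[OF assms(1)] by simp
  have sq: "p ^ j \<le> p ^ j * p ^ j" using pj by simp
  show ?thesis
  proof (cases "p = 2")
    case True
    thus ?thesis unfolding t using sq by (simp add: k power2_eq_square)
  next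
    case False
    hence "p \<ge> 3" using prime_ge_2_nat[OF assms(1)] by simp
    then obtain q where q: "p = q + 3" by (metis add.commute le_Suc_ex)
    have "p \<le> (p - 1) ^ 2" by (simp add: q power2_eq_square)
    hence "p ^ j * p \<le> (p ^ j * p ^ j) * (p - 1) ^ 2" using sq by (intro mult_mono) auto
    also have "\<dots> = totient (p ^ k) ^ 2" by (simp add: t power2_eq_square mult_ac)
    finally show ?thesis using False by (simp add: k mult.commute)
  qed
qed

text \<open>Both sides are compared along a coprime splitting \<open>n = p ^ k * r\<close>.
  Recording parity ensures that the factor 2 is paid only once, by the prime 2.\<close>

lemma le_totient_square_aux:
  assumes "n > 0"
  shows "n \<le> (if even n then 2 else 1) * totient n ^ 2"
  using assms
proof (induction n rule: less_induct)
  case (less n)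
  show ?case
  proof (cases "n = 1")
    case False
    then obtain p where p: "prime p" "p dvd n" using prime_factor_nat by blast
    define k where "k = multiplicity p n"
    have n0: "n \<noteq> 0" using less.prems by simp
    have k: "k > 0" unfolding k_def using p n0 by (simp add: prime_multiplicity_gt_zero_iff)
    obtain r where r: "n = p ^ k * r" "\<not> p dvd r"
      using multiplicity_decompose'[of n p] n0 p unfolding k_def
      by (metis mult.commute not_prime_unit)
    have r0: "r > 0" using r n0 by (intro Nat.gr0I) auto
    have "p ^ k > 1" using p k prime_gt_1_nat one_less_power by blast
    hence "r < n" using r r0 by simp
    note IH = less.IH[OF this r0]
    have cop: "coprime (p ^ k) r" using p r by (simp add: prime_imp_coprime)
    have ev: "even n \<longleftrightarrow> p = 2 \<or> even r"
      using r k p primes_dvd_imp_eq[OF two_is_prime_nat p(1)] by auto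
    have "n \<le> ((if p = 2 then 2 else 1) * totient (p ^ k) ^ 2) *
        ((if even r then 2 else 1) * totient r ^ 2)"
      unfolding r(1) using prime_power_le_totient_square[OF p(1) k] IH by (intro mult_mono) auto
    also have "\<dots> = (if p = 2 then 2 else 1) * (if even r then 2 else 1) * totient n ^ 2"
      unfolding r(1) totient_mult_coprime[OF cop] by (simp add: power_mult_distrib mult_ac)
    also have "(if p = 2 then 2 else 1) * (if even r then 2 else 1) = (if even n then 2 else 1 :: nat)"
      using ev r(2) by auto
    finally show ?thesis .
  qed auto
qed

lemma le_totient_square: "n \<le> 2 * totient n ^ 2"
  using le_totient_square_aux[of n] by (cases "n = 0") (auto split: if_splits)

section \<open>Degrees in a tower\<close>

lemma vector_space_rat_complex: "vector_space (\<lambda>(q::rat) (x::complex). of_rat q * x)"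
  by unfold_locales (auto simp: algebra_simps of_rat_add of_rat_mult)

text \<open>A linear relation among these powers is a polynomial of degree below that of
  \<open>g\<close> vanishing at \<open>a\<close>.\<close>

lemma minpoly_powers_independent:
  fixes c :: "nat \<Rightarrow> complex"
  assumes "complex_subring S" "is_minpoly S a g" "\<And>i. i < degree g \<Longrightarrow> c i \<in> S"
    and "(\<Sum>i<degree g. c i * a ^ i) = 0" "j < degree g"
  shows "c j = 0"
proof -
  interpret S: complex_subring S by fact
  define p where "p = (\<Sum>i<degree g. monom (c i) i)"
  have coeff: "coeff p i = (if i < degree g then c i else 0)" for i
    by (simp add: p_def coeff_sum)
  have p: "p \<in> polys_over S" "poly p a = 0"
    using assms(3,4) by (auto simp: p_def poly_sum poly_monom intro!: S.polys_over_sum)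
  have "degree p < degree g"
    using assms(5) unfolding p_def by (intro degree_sum_less) (auto intro: le_less_trans[OF degree_monom_le])
  hence "p = 0" using p assms(2) by (auto simp: is_minpoly_def not_le)
  thus ?thesis using coeff[of j] assms(5) by simp
qed

text \<open>One half of the tower law. The products \<open>z ^ i * a ^ j\<close> are independent
  over the rationals: compare coefficients first in powers of \<open>a\<close>, then in powers of
  \<open>z\<close>. They lie in the span of the first \<open>degree f\<close> powers of
  \<open>a\<close>.\<close>

lemma degree_tower_le:
  assumes f: "is_minpoly \<rat> a f" and z: "z \<in> adjoin \<rat> a"
    and g: "is_minpoly \<rat> z g" and h: "is_minpoly (adjoin \<rat> z) a h"
  shows "degree h * degree g \<le> degree f"
proof -
  interpret Q: vector_space "\<lambda>(q::rat) (x::complex). of_rat q * x"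
    by (rule vector_space_rat_complex)
  interpret L: complex_subring "adjoin \<rat> z" by (rule Rats.complex_subring_adjoin)
  interpret K: complex_subring "adjoin \<rat> a" by (rule Rats.complex_subring_adjoin)
  define I where "I = {..<degree h} \<times> {..<degree g}"
  define F where "F = (\<lambda>(j, i). z ^ i * a ^ j)"
  have zero: "q x = 0" if q: "(\<Sum>x\<in>I. of_rat (q x) * F x) = 0" and x: "x \<in> I"
    for q :: "nat \<times> nat \<Rightarrow> rat" and x
  proof -
    obtain j i where ji: "x = (j, i)" "j < degree h" "i < degree g" using x by (auto simp: I_def)
    have "(\<Sum>j<degree h. (\<Sum>i<degree g. of_rat (q (j, i)) * z ^ i) * a ^ j) = 0"
      using q by (simp add: I_def F_def sum.cartesian_product' sum_distrib_left mult_ac)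
    hence "(\<Sum>i<degree g. of_rat (q (j, i)) * z ^ i) = 0"
    proof (rule minpoly_powers_independent[OF L.complex_subring_axioms h, rotated])
      show "(\<Sum>i<degree g. of_rat (q (j, i)) * z ^ i) \<in> adjoin \<rat> z" for j
        using Rats.subset_adjoin[of z] Rats.generator_in_adjoin[of z]
        by (intro L.sum_closed L.mult_closed L.power_closed) auto
    qed (use ji in auto)
    hence "(of_rat (q (j, i)) :: complex) = 0"
      by (rule minpoly_powers_independent[OF Rats.complex_subring_axioms g, rotated]) (use ji in auto)
    thus ?thesis using ji by simp
  qed
  have fin: "finite I" by (simp add: I_def)
  \<comment> \<open>Independence concerns the set of products, so coincidences must be excluded; one
    would itself be a nontrivial relation.\<close>
  have inj: "inj_on F I"
  proof (rule inj_onI, rule ccontr)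
    fix x y assume xy: "x \<in> I" "y \<in> I" "F x = F y" "x \<noteq> y"
    define q :: "nat \<times> nat \<Rightarrow> rat" where "q w = (if w = x then 1 else if w = y then - 1 else 0)" for w
    have "(\<Sum>w\<in>I. of_rat (q w) * F w) = (\<Sum>w\<in>{x, y}. of_rat (q w) * F w)"
      using xy fin by (intro sum.mono_neutral_right) (auto simp: q_def)
    also have "\<dots> = 0" using xy by (simp add: q_def)
    finally show False using zero[of q x] xy by (simp add: q_def)
  qed
  have "Q.independent (F ` I)"
  proof (rule Q.independent_if_scalars_zero)
    fix u x assume u: "(\<Sum>x\<in>F ` I. of_rat (u x) * x) = 0" and x: "x \<in> F ` I"
    have "(\<Sum>x\<in>I. of_rat (u (F x)) * F x) = 0"
      using u by (simp add: sum.reindex[OF inj])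
    thus "u x = 0" using zero[of "u \<circ> F"] x by auto
  qed (use fin in auto)
  moreover have "F ` I \<subseteq> Q.span ((\<lambda>j. a ^ j) ` {..<degree f})"
  proof
    fix y assume "y \<in> F ` I"
    hence "y \<in> adjoin \<rat> a"
      using z Rats.generator_in_adjoin[of a] by (auto simp: F_def)
    then obtain p where p: "p \<in> polys_over \<rat>" "y = poly p a" by (elim adjoinE)
    obtain q where q: "q \<in> polys_over \<rat>" "poly q a = y" "degree q < degree f"
      using Rats.minpoly_reduce[OF f p(1)] p(2) by metis
    have "(\<Sum>i\<le>degree q. coeff q i * a ^ i) \<in> Q.span ((\<lambda>j. a ^ j) ` {..<degree f})"
    proof (rule Q.span_sum)
      fix i assume i: "i \<in> {..degree q}"
      obtain c where "coeff q i = of_rat c"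
        using Rats.coeff_polys_over[OF q(1), of i] by (elim Rats_cases)
      moreover have "of_rat c * a ^ i \<in> Q.span ((\<lambda>j. a ^ j) ` {..<degree f})"
        using i q(3) by (intro Q.span_scale Q.span_base) auto
      ultimately show "coeff q i * a ^ i \<in> Q.span ((\<lambda>j. a ^ j) ` {..<degree f})" by simp
    qed
    thus "y \<in> Q.span ((\<lambda>j. a ^ j) ` {..<degree f})" using q(2) by (simp add: poly_altdef)
  qed
  ultimately have "card (F ` I) \<le> card ((\<lambda>j. a ^ j) ` {..<degree f})"
    using Q.independent_span_bound[of "(\<lambda>j. a ^ j) ` {..<degree f}" "F ` I"] by simp
  also have "\<dots> \<le> degree f" using card_image_le[of "{..<degree f}"] by simp
  finally show ?thesis unfolding card_image[OF inj] by (simp add: I_def)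
qed

section \<open>Radicals in a cyclotomic field\<close>

text \<open>\<open>g\<close> divides \<open>monom 1 n - 1\<close>, whose derivative vanishes at most
  at 0, which is not a root. So \<open>g\<close> has only simple roots.\<close>

lemma card_roots_minpoly_root_of_unity:
  assumes "n > 0" "z ^ n = 1" "is_minpoly \<rat> z g"
  shows "card {x. poly g x = 0} = degree g"
proof -
  have "g dvd monom 1 n - 1"
    using assms(2) by (intro Rats.minpoly_dvd[OF assms(3)]) (auto simp: poly_monom)
  then obtain k where k: "monom 1 n - 1 = g * k" by (elim dvdE)
  have "rsquarefree g"
    unfolding rsquarefree_roots
  proof (intro allI notI)
    fix a assume a: "poly g a = 0 \<and> poly (pderiv g) a = 0"
    have "poly (pderiv (monom 1 n - 1)) a = 0" using a unfolding k by (simp add: pderiv_mult)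
    hence "a = 0 \<and> n \<noteq> 1" using assms(1) by (auto simp: pderiv_diff pderiv_monom poly_monom)
    moreover have "poly (monom 1 n - 1) a = 0" using a unfolding k by simp
    ultimately show False using assms(1) by (simp add: poly_monom power_0_left)
  qed
  hence "g = (\<Prod>x | poly g x = 0. [:-x, 1:])"
    using complex_poly_decompose_rsquarefree[of g] assms(3) by (simp add: is_minpoly_def)
  hence "degree g = degree (\<Prod>x | poly g x = 0. [:-x, 1:])" by simp
  also have "\<dots> = card {x. poly g x = 0}" by (subst degree_prod_sum_eq) auto
  finally show ?thesis by simp
qed

text \<open>
  Each conjugate of \<open>b\<close> is \<open>b\<close> times an \<open>n\<close>-th root of unity, so \<open>b\<^sup>n\<close> is fixed by conjugation.
\<close>

lemma radical_in_cyclotomic_field: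
  assumes n: "n > 0" and z: "z = cis (2 * pi / real n)"
    and b: "b \<in> adjoin \<rat> z" "b \<noteq> 0" "b ^ m \<in> \<rat>"
    and unity: "\<And>x. x \<in> adjoin \<rat> z \<Longrightarrow> x ^ m = 1 \<Longrightarrow> x ^ n = 1"
  shows "b ^ n \<in> \<rat>"
proof -
  have zn: "z ^ n = 1" using cis_root_of_unity[OF n] z by simp
  obtain g where g: "is_minpoly \<rat> z g" using root_of_unity_minpoly_exists[OF n zn] by blast
  interpret L: complex_subfield "adjoin \<rat> z" by (rule Rats.complex_subfield_adjoin[OF g])
  have g0: "g \<noteq> 0" using g by (auto simp: is_minpoly_def)
  obtain P where P: "P \<in> polys_over \<rat>" "b = poly P z" using b(1) by (elim adjoinE)
  have P_root: "poly P a ^ n = b ^ n" if a: "poly g a = 0" for a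
  proof -
    have "g dvd P ^ m - [:b ^ m:]"
      using P b(3) by (intro Rats.minpoly_dvd[OF g]) auto
    hence "poly (P ^ m - [:b ^ m:]) a = 0" using a by (rule poly_dvd_root)
    hence "(poly P a / b) ^ m = 1" using b(2) by (simp add: power_divide)
    \<comment> \<open>The field generated by \<open>z\<close> contains every conjugate of
      \<open>z\<close>, so the quotient of a conjugate of \<open>b\<close> by \<open>b\<close> stays
      in it.\<close>
    moreover have "a \<in> adjoin \<rat> z"
      using root_of_unity_in_adjoin[OF Rats.complex_subring_axioms n]
        minpoly_root_of_unity_roots[OF zn g a] z by simp
    hence "poly P a / b \<in> adjoin \<rat> z"
      using P(1) polys_over_mono[OF L.Rats_subset] b(1) by auto
    ultimately have "(poly P a / b) ^ n = 1" by (intro unity)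
    thus ?thesis using b(2) by (simp add: power_divide)
  qed
  obtain q where q: "q \<in> polys_over \<rat>" "poly q z = poly (P ^ n) z" "degree q < degree g"
    using Rats.minpoly_reduce[OF g, of "P ^ n"] P(1) by auto
  have "g dvd q - P ^ n"
    using q P(1) by (intro Rats.minpoly_dvd[OF g]) auto
  hence q_root: "poly (q - [:b ^ n:]) a = 0" if "poly g a = 0" for a
    using poly_dvd_root[of g "q - P ^ n" a] that P_root[OF that] by simp
  \<comment> \<open>\<open>q\<close> takes the value \<open>b ^ n\<close> at all
    \<open>degree g\<close> distinct roots of \<open>g\<close> but has smaller degree, so it is
    constant, with a rational coefficient.\<close>
  have "q - [:b ^ n:] = 0"
  proof (rule ccontr)
    assume nz: "q - [:b ^ n:] \<noteq> 0"
    have "degree g \<le> card {x. poly (q - [:b ^ n:]) x = 0}"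
      unfolding card_roots_minpoly_root_of_unity[OF n zn g, symmetric]
      using nz q_root by (intro card_mono poly_roots_finite) auto
    also have "\<dots> \<le> degree (q - [:b ^ n:])" using nz by (rule card_poly_roots_bound)
    also have "\<dots> < degree g" using q(3) by (intro degree_diff_less) auto
    finally show False by simp
  qed
  hence "b ^ n = coeff q 0" by (metis eq_iff_diff_eq_0 coeff_pCons_0)
  thus ?thesis using q(1) by simp
qed

text \<open>Here \<open>n\<close> is the order of the finite group \<open>U\<close>. Multiplication
  by \<open>x\<close> permutes \<open>U\<close>, and comparing the products over \<open>U\<close>
  gives \<open>x ^ n = 1\<close>; counting then turns the inclusion into equality.\<close>

lemma roots_of_unity_in_complex_subfield:
  assumes "complex_subfield K" "m > 0"
  obtains n where "n > 0" "{x\<in>K. x ^ m = 1} = {x. x ^ n = 1}"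
proof -
  interpret K: complex_subfield K by fact
  define U where "U = {x\<in>K. x ^ m = 1}"
  define n where "n = card U"
  have fin: "finite U"
    unfolding U_def by (rule finite_subset[OF _ finite_roots_unity[of m]]) (use assms(2) in auto)
  have "1 \<in> U" by (simp add: U_def)
  hence n: "n > 0" using fin by (auto simp: n_def card_gt_0_iff)
  have "x ^ n = 1" if x: "x \<in> U" for x
  proof -
    have x0: "x \<noteq> 0" using x assms(2) by (auto simp: U_def power_0_left)
    have "bij_betw (\<lambda>y. x * y) U U"
      by (rule bij_betwI[of _ _ _ "\<lambda>y. y / x"])
         (use x x0 in \<open>auto simp: U_def power_mult_distrib power_divide\<close>)
    hence "(\<Prod>y\<in>U. y) = (\<Prod>y\<in>U. x * y)" by (rule prod.reindex_bij_betw[symmetric])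
    also have "\<dots> = x ^ n * (\<Prod>y\<in>U. y)" by (simp add: prod.distrib n_def)
    finally have "(\<Prod>y\<in>U. y) = x ^ n * (\<Prod>y\<in>U. y)" .
    moreover have "(\<Prod>y\<in>U. y) \<noteq> 0"
      using fin assms(2) by (auto simp: U_def power_0_left)
    ultimately show ?thesis by simp
  qed
  hence "U = {x. x ^ n = 1}"
    using card_roots_unity_eq[OF n] finite_roots_unity[of n] n
    by (intro card_subset_eq) (auto simp: n_def)
  thus ?thesis using that n by (simp add: U_def)
qed

section \<open>Binomial multiples\<close>

lemma map_poly_of_rat_mult:
  "map_poly of_rat (p * q) = (map_poly of_rat p * map_poly of_rat q :: complex poly)"
  by (intro poly_eqI) (simp add: coeff_map_poly coeff_mult of_rat_sum of_rat_mult)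

lemma map_poly_of_rat_dvd:
  "p dvd q \<Longrightarrow> map_poly of_rat p dvd (map_poly of_rat q :: complex poly)"
  by (auto simp: map_poly_of_rat_mult elim!: dvdE)

lemma map_poly_of_rat_add:
  "map_poly of_rat (p + q) = (map_poly of_rat p + map_poly of_rat q :: complex poly)"
  by (intro poly_eqI) (simp add: coeff_map_poly of_rat_add)

lemma map_poly_of_rat_binomial:
  "map_poly of_rat (monom 1 k - [:r:]) = (monom 1 k - [:of_rat r:] :: complex poly)"
  by (intro poly_eqI) (auto simp: coeff_map_poly coeff_pCons of_rat_diff split: nat.split)

text \<open>A nonzero rational polynomial \<open>g\<close> of least degree vanishing at
  \<open>a\<close> divides every other one. It is a nonunit divisor of the irreducible
  \<open>f\<close>, so \<open>f\<close> divides \<open>g\<close> in turn.\<close>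

lemma irreducible_dvd_if_common_root:
  fixes f p :: "rat poly" and a :: complex
  assumes "irreducible f" "poly (map_poly of_rat f) a = 0" "poly (map_poly of_rat p) a = 0"
  shows "f dvd p"
proof -
  define Q where "Q q \<longleftrightarrow> q \<noteq> 0 \<and> poly (map_poly of_rat q) a = 0" for q :: "rat poly"
  have "Q f" using assms by (auto simp: Q_def)
  then obtain g where g: "Q g" "\<And>q. Q q \<Longrightarrow> degree g \<le> degree q"
    using ex_has_least_nat[of Q f degree] by blast
  have g_dvd: "g dvd q" if "poly (map_poly of_rat q) a = 0" for q
  proof -
    have "poly (map_poly of_rat (q div g * g + q mod g)) a = 0" using that by simp
    hence "poly (map_poly of_rat (q mod g)) a = 0"
      using g(1) by (simp only: map_poly_of_rat_add map_poly_of_rat_mult Q_def poly_add poly_mult) simp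
    hence "q mod g = 0"
      using g degree_mod_less[of g q] by (force simp: Q_def)
    thus ?thesis by (simp add: mod_eq_0_iff_dvd)
  qed
  have "\<not> is_unit g"
  proof
    assume "is_unit g"
    then obtain c where c: "g = [:c:]" by (auto simp: is_unit_poly_iff)
    thus False using g(1) by (cases "c = 0") (auto simp: Q_def map_poly_pCons)
  qed
  hence "f dvd g"
    using assms(1) g_dvd[OF assms(2)] by (auto simp: irreducible_altdef)
  thus ?thesis using g_dvd[OF assms(3)] by (rule dvd_trans)
qed

lemma complex_poly_root_exists:
  assumes "degree (p :: complex poly) > 0"
  shows "\<exists>a. poly p a = 0"
proof -
  have "size (proots p) > 0" using assms by (simp add: size_proots_complex)
  then obtain a where "a \<in># proots p" by (metis multiset_nonemptyE nonempty_has_size)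
  moreover have "p \<noteq> 0" using assms by auto
  ultimately show ?thesis by auto
qed

lemma irreducible_minpoly:
  fixes f :: "rat poly" and a :: complex
  assumes "irreducible f" "poly (map_poly of_rat f) a = 0"
  shows "\<exists>g. is_minpoly \<rat> a g \<and> degree g = degree f"
proof -
  define F :: "complex poly" where "F = map_poly of_rat f"
  have f0: "f \<noteq> 0" using assms(1) by auto
  have deg: "degree (map_poly of_rat p :: complex poly) = degree p" for p :: "rat poly"
    by (rule degree_map_poly) auto
  have F0: "F \<noteq> 0" using f0 by (simp add: F_def map_poly_eq_0_iff)
  define g where "g = smult (inverse (lead_coeff F)) F"
  have F: "F \<in> polys_over \<rat>" unfolding F_def by (rule map_poly_of_rat_polys_over)
  have g: "g \<in> polys_over \<rat>" "lead_coeff g = 1" "poly g a = 0" "degree g = degree f"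
    using F F0 leading_coeff_neq_0[OF F0] assms(2) deg[of f]
    by (auto simp: g_def F_def[symmetric] Rats.coeff_polys_over simp del: leading_coeff_0_iff)
  have "p = 0 \<or> degree g \<le> degree p" if p: "p \<in> polys_over \<rat>" "poly p a = 0" for p
  proof -
    obtain q where q: "p = map_poly of_rat q"
      using ratpolyE[OF Rats.coeff_polys_over[OF p(1)]] by blast
    have "f dvd q"
      using irreducible_dvd_if_common_root[OF assms] p(2) q by simp
    hence "q = 0 \<or> degree f \<le> degree q" using dvd_imp_degree_le by blast
    thus ?thesis using q g(4) by (auto simp: deg)
  qed
  thus ?thesis using g by (intro exI[of _ g]) (auto simp: is_minpoly_def)
qed

text \<open>The constant coefficient is the product of the negated roots, counted with multiplicity.
  This will identify a relative norm of \<open>a\<close> up to a root of unity.\<close>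

lemma const_coeff_power_if_roots_power:
  assumes "lead_coeff (h :: complex poly) = 1" "\<And>a. poly h a = 0 \<Longrightarrow> a ^ m = r"
  shows "poly h 0 ^ m = ((-1) ^ m * r) ^ degree h"
proof -
  have h0: "h \<noteq> 0" using assms(1) by auto
  have "(\<Prod>a\<in>#A. 0 - a) ^ m = ((-1) ^ m * r) ^ size A" if "\<And>a. a \<in># A \<Longrightarrow> a ^ m = r" for A
    using that
  proof (induction A)
    case (add a A)
    have "(- a) ^ m = (-1) ^ m * r" using add.prems[of a] by (subst power_minus) simp
    moreover have "(\<Prod>a\<in>#A. 0 - a) ^ m = ((-1) ^ m * r) ^ size A" using add by simp
    moreover have "(\<Prod>b\<in>#add_mset a A. 0 - b) ^ m = (- a) ^ m * (\<Prod>b\<in>#A. 0 - b) ^ m"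
      by (simp only: image_mset_add_mset prod_mset.add_mset diff_0 power_mult_distrib)
    ultimately show ?case by (simp only: size_add_mset power_Suc)
  qed auto
  from this[of "proots h"] have "(\<Prod>a\<in>#proots h. 0 - a) ^ m = ((-1) ^ m * r) ^ degree h"
    using assms(2) h0 by (simp add: size_proots_complex)
  moreover have "poly h 0 = (\<Prod>a\<in>#proots h. 0 - a)"
    using arg_cong[OF monic_complex_poly_decompose[OF assms(1)], of "\<lambda>h. poly h 0"]
    by (simp only: poly_prod_mset_linear)
  ultimately show ?thesis by simp
qed

lemma binomial_multiple_of_small_degree:
  fixes f :: "rat poly"
  assumes f: "irreducible f" "degree f \<ge> 2" and m: "has_binomial_multiple_of_degree f m"
  shows "\<exists>k\<le>2 * degree f ^ 2. has_binomial_multiple_of_degree f k"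
proof -
  obtain r :: rat where m0: "m \<ge> 1" and r: "f dvd monom 1 m - [:r:]"
    using m by (auto simp: has_binomial_multiple_of_degree_def)
  define F :: "complex poly" where "F = map_poly of_rat f"
  have "degree F > 0" using f(2) by (simp add: F_def degree_map_poly)
  then obtain a where a: "poly F a = 0" using complex_poly_root_exists by blast
  define K where "K = adjoin \<rat> a"
  have F_dvd: "F dvd monom 1 m - [:of_rat r:]"
    using map_poly_of_rat_dvd[OF r] by (simp add: F_def map_poly_of_rat_binomial)
  have pow: "x ^ m = of_rat r" if "poly F x = 0" for x
    using poly_dvd_root[OF F_dvd that] by (simp add: poly_monom)
  have a0: "a \<noteq> 0"
  proof
    assume "a = 0"
    hence "f dvd [:0, 1:]"
      using a by (intro irreducible_dvd_if_common_root[OF f(1), of a])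
        (auto simp: F_def map_poly_pCons)
    hence "degree f \<le> degree [:0, 1 :: rat:]" by (rule dvd_imp_degree_le) simp
    thus False using f(2) by simp
  qed
  hence r0: "r \<noteq> 0" using pow[OF a] by auto
  obtain g where g: "is_minpoly \<rat> a g" "degree g = degree f"
    using irreducible_minpoly[OF f(1)] a by (auto simp: F_def)
  interpret K: complex_subfield K unfolding K_def by (rule Rats.complex_subfield_adjoin[OF g(1)])
  have aK: "a \<in> K" unfolding K_def by (rule Rats.generator_in_adjoin)
  obtain n where n: "n > 0" "{x\<in>K. x ^ m = 1} = {x. x ^ n = 1}"
    using roots_of_unity_in_complex_subfield[OF K.complex_subfield_axioms, of m] m0 by auto
  define z where "z = cis (2 * pi / real n)"
  have zn: "z ^ n = 1" unfolding z_def using n(1) by (rule cis_root_of_unity)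
  have zK: "z \<in> K" using n(2) zn by auto
  define L where "L = adjoin \<rat> z"
  obtain gz where gz: "is_minpoly \<rat> z gz"
    using root_of_unity_minpoly_exists[OF n(1) zn] by blast
  interpret L: complex_subfield L unfolding L_def by (rule Rats.complex_subfield_adjoin[OF gz])
  have LK: "L \<subseteq> K"
    unfolding L_def using K.complex_subring_axioms K.Rats_subset zK by (rule Rats.adjoin_subset)
  have "F \<in> polys_over L"
    using map_poly_of_rat_polys_over polys_over_mono[OF L.Rats_subset] by (auto simp: F_def)
  moreover have "F \<noteq> 0" using \<open>degree F > 0\<close> by auto
  ultimately obtain h where h: "is_minpoly L a h" "h dvd F"
    using L.minpoly_exists[of F a] L.minpoly_dvd[of a _ F] a by blast
  define s where "s = degree h"
  \<comment> \<open>The numerator is the product of the roots of \<open>h\<close>, all with the same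
    \<open>m\<close>-th power as \<open>a\<close>. So \<open>y\<close> is an \<open>m\<close>-th
    root of unity in \<open>K\<close>, hence lies in \<open>L\<close>.\<close>
  define y where "y = (-1) ^ s * poly h 0 / a ^ s"
  have h0L: "poly h 0 \<in> L" using h(1) by (auto simp: is_minpoly_def)
  have "poly h 0 ^ m = ((-1) ^ m * of_rat r) ^ s"
    unfolding s_def using h pow poly_dvd_root[OF h(2)]
    by (intro const_coeff_power_if_roots_power) (auto simp: is_minpoly_def)
  hence "(a ^ s) ^ m * y ^ m = ((-1) ^ s) ^ m * ((-1) ^ m * of_rat r) ^ s"
    using a0 by (simp add: y_def power_divide power_mult_distrib)
  \<comment> \<open>Two equal signs meet, one from the definition of \<open>y\<close> and one from
    the constant coefficient of \<open>h\<close>; they cancel.\<close>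
  also have "\<dots> = (((-1) ^ s) ^ m * ((-1) ^ s) ^ m) * (a ^ s) ^ m"
    by (simp add: pow[OF a, symmetric] power_mult_distrib power_mult[symmetric] mult.commute)
  also have "((-1) ^ s) ^ m * ((-1) ^ s) ^ m = (1 :: complex)"
    by (simp flip: power_mult_distrib)
  finally have "y ^ m = 1" using a0 by simp
  moreover have "y \<in> K" using h0L LK aK by (auto simp: y_def)
  ultimately have "y ^ n = 1" using n(2) by auto
  hence yL: "y \<in> L"
    unfolding L_def z_def using Rats.complex_subring_axioms n(1) by (intro root_of_unity_in_adjoin)
  have y0: "y \<noteq> 0" using \<open>y ^ n = 1\<close> n(1) by (auto simp: power_0_left)
  have "a ^ s = (-1) ^ s * poly h 0 / y" using a0 y0 by (simp add: y_def field_simps)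
  hence asL: "a ^ s \<in> L" using h0L yL by auto
  have "(a ^ s) ^ m \<in> \<rat>"
    using pow[OF a] by (metis Rats_of_rat Rats_power power_commutes power_mult mult.commute)
  hence "(a ^ s) ^ n \<in> \<rat>"
    using radical_in_cyclotomic_field[OF n(1) z_def asL[unfolded L_def]] a0 n(2) LK
    by (auto simp: L_def)
  then obtain q :: rat where q: "a ^ (s * n) = of_rat q"
    by (auto simp: power_mult elim: Rats_cases)
  have "f dvd monom 1 (s * n) - [:q:]"
    using a q by (intro irreducible_dvd_if_common_root[OF f(1), of a])
      (auto simp: F_def map_poly_of_rat_binomial poly_monom)
  moreover have spos: "s > 0" unfolding s_def by (rule L.minpoly_degree_pos[OF h(1)])
  ultimately have "has_binomial_multiple_of_degree f (s * n)"
    using n(1) by (auto simp: has_binomial_multiple_of_degree_def Suc_le_eq)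
  moreover have "s * n \<le> 2 * degree f ^ 2"
  proof -
    have "n \<le> 2 * totient n ^ 2" by (rule le_totient_square)
    also have "\<dots> \<le> 2 * degree gz ^ 2"
      using totient_le_degree_minpoly[OF n(1) gz[unfolded z_def]] by simp
    finally have "s * n \<le> s * (2 * degree gz ^ 2)" by simp
    \<comment> \<open>The spare factor \<open>s\<close> completes the square of
      \<open>s * degree gz\<close>, which the tower inequality bounds.\<close>
    also have "\<dots> \<le> s * (s * (2 * degree gz ^ 2))" using spos by simp
    also have "\<dots> = 2 * (s * degree gz) ^ 2" by (simp add: power2_eq_square)
    also have "s * degree gz \<le> degree f"
      using degree_tower_le[OF g(1) zK[unfolded K_def] gz h(1)[unfolded L_def]] g(2)
      by (simp add: s_def)
    finally show ?thesis by simp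
  qed
  ultimately show ?thesis by blast
qed

section \<open>Comparison of the quadratic bound with the iterated logarithm\<close>

text \<open>For \<open>d \<ge> 9\<close>, \<open>ln (real d) \<ge> 3 * ln 2 \<ge> 2\<close>, so the
  iterated logarithm is at least \<open>ln 2 \<ge> 2 / 3\<close>, and three times \<open>d\<close>
  times it is at least \<open>2 * d\<close>. Smaller \<open>d\<close> use the offset 7 and crude
  bounds from \<open>1 - 1 / x \<le> ln x\<close>.\<close>

lemma two_mult_le_ceiling_loglog:
  fixes d :: nat
  assumes "d \<ge> 2"
  shows "2 * real d \<le> real_of_int \<lceil>3 * real d * ln (ln (real d))\<rceil> + 7"
proof -
  define c where "c = \<lceil>3 * real d * ln (ln (real d))\<rceil>"
  have lower: "1 - 1 / x \<le> ln x" if "x > 0" for x :: real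
    using ln_le_minus_one[of "1 / x"] that by (simp add: ln_div)
  have mono: "ln (ln x) \<ge> 1 - 1 / y" if "ln x \<ge> y" "y > 0" for x y :: real
    using lower[of y] that by (smt (verit) ln_le_cancel_iff)
  have ln2: "ln (2::real) \<ge> 2 / 3" using ln2_ge_two_thirds by simp
  \<comment> \<open>An integer strictly below a real is at least one below its ceiling, so the
    offset 7 becomes a slack of 8.\<close>
  have ceil: "2 * real d \<le> real_of_int c + 7" if "2 * int d - 8 < 3 * real d * ln (ln (real d))"
  proof -
    have "2 * int d - 8 < c" unfolding c_def using that by (simp add: less_ceiling_iff)
    hence "2 * int d \<le> c + 7" by simp
    hence "real_of_int (2 * int d) \<le> real_of_int (c + 7)" by (simp only: of_int_le_iff)
    thus ?thesis by simp
  qed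
  have pos: "ln (ln (real d)) > 0" if "d \<ge> 3"
  proof -
    have "exp 1 < real d" using e_less_272 that by simp
    hence "ln (exp 1) < ln (real d)" using that by (subst ln_less_cancel_iff) auto
    hence "1 < ln (real d)" by simp
    thus ?thesis by simp
  qed
  consider "d = 2" | "d = 3 \<or> d = 4" | "d = 5 \<or> d = 6" | "d = 7 \<or> d = 8" | "d \<ge> 9"
    using assms by linarith
  hence "2 * int d - 8 < 3 * real d * ln (ln (real d))"
  proof cases
    \<comment> \<open>The iterated logarithm is negative here: it is at least -1/2, so the right
      side is at least -3, above -4.\<close>
    case 1
    thus ?thesis using mono[of "2/3" 2] ln2 by simp
  next
    case 2
    \<comment> \<open>The slack of 8 makes the left side nonpositive, so positivity
      suffices.\<close>
    hence "3 * real d * ln (ln (real d)) > 0" using pos by (intro mult_pos_pos) auto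
    moreover have "real_of_int (2 * int d - 8) \<le> 0" using 2 by auto
    ultimately show ?thesis by linarith
  next
    case 3
    have "ln (4::real) = 2 * ln 2" using ln_realpow[of 2 2] by simp
    hence "ln (real d) \<ge> 4 / 3" using 3 ln2 ln_mono[of 4 "real d"] by auto
    hence "ln (ln (real d)) \<ge> 1 / 4" using mono[of "4/3" "real d"] by simp
    thus ?thesis using 3 by auto
  next
    case 4
    have "ln (6::real) = 2 * ln 2 + ln (3/2)"
      using ln_mult[of "2^2" "3/2::real"] ln_realpow[of 2 2] by simp
    moreover have "ln (3/2 :: real) \<ge> 1/3" using lower[of "3/2"] by simp
    ultimately have "ln (real d) \<ge> 5 / 3" using 4 ln2 ln_mono[of 6 "real d"] by auto
    hence "ln (ln (real d)) \<ge> 2 / 5" using mono[of "5/3" "real d"] by simp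
    thus ?thesis using 4 by auto
  next
    case 5
    have "ln (8::real) = 3 * ln 2" using ln_realpow[of 2 3] by simp
    hence "ln (real d) \<ge> 2" using 5 ln2 ln_mono[of 8 "real d"] by auto
    hence "ln (ln (real d)) \<ge> ln 2" using mono by simp
    hence "ln (ln (real d)) \<ge> 2 / 3" using ln2 by simp
    hence "3 * real d * ln (ln (real d)) \<ge> 3 * real d * (2 / 3)" by (intro mult_left_mono) auto
    thus ?thesis by simp
  qed
  thus ?thesis using ceil by (simp add: c_def)
qed

theorem theorem3p3:
  fixes f :: "rat poly" and d m :: nat
  assumes "irreducible f"
    and "degree f = d"
    and "d \<ge> 2"
    and "has_binomial_multiple_of_degree f m"
    and "\<And>m'. has_binomial_multiple_of_degree f m' \<Longrightarrow> m \<le> m'"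
  shows "real m \<le> real d * (real_of_int \<lceil>3 * real d * ln (ln (real d))\<rceil> + 7)"
proof -
  obtain k where "k \<le> 2 * d ^ 2" "has_binomial_multiple_of_degree f k"
    using binomial_multiple_of_small_degree[OF assms(1) _ assms(4)] assms(2,3) by auto
  hence "m \<le> 2 * d ^ 2" using assms(5) le_trans by blast
  hence "real m \<le> real (2 * d ^ 2)" by (simp only: of_nat_le_iff)
  also have "\<dots> = real d * (2 * real d)" by (simp add: power2_eq_square)
  also have "\<dots> \<le> real d * (real_of_int \<lceil>3 * real d * ln (ln (real d))\<rceil> + 7)"
    using two_mult_le_ceiling_loglog[OF assms(3)] by (intro mult_left_mono) auto
  finally show ?thesis .
qed

end
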